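(* Let $M$ be a relational Fraïssé structure with strong amalgamation. Then the following are equivalent: (i) $M$ has the canonical infinite point-Ramsey property; (ii) $M$ has the galah property; (iii) $M$ is locally replicable.
   Context: A Fraïssé structure is a countably infinite ultrahomogeneous first-order structure; it is relational if its language is relational. The age $\mathrm{Age}(M)$ is the class of finite structures embeddable in $M$. $M$ has strong amalgamation if for all pairs of embeddings $B_0 \leftarrow A \rightarrow B_1$ in $\mathrm{Age}(M)$ there is an amalgam $B_0 \rightarrow C \leftarrow B_1$ in $\mathrm{Age}(M)$ such that the images of $B_0$ and $B_1$ in $C$ intersect exactly in the image of $A$. A copy of $M$ in a set or structure is an induced substructure isomorphic to $M$; subsets of $M$ are regarded as induced substructures. $M$ has the canonical infinite point-Ramsey property if for each colouring $\chi : M \to \omega$ there is a copy of $M$ in $M$ which is monochromatic (all elements have the same colour) or heterochromatic (all elements have pairwise different colours). $M$ has the galah property if for each partition $(C, D)$ of the domain of $M$ into two parts, $C \cong M$ or $D$ contains a copy of $M$. Topology on $M$: for each finite substructure $A$ of $M$ (possibly empty) and each $b \in M \setminus A$, the set $\{v \in M \mid \mathrm{qftp}(v/A) = \mathrm{qftp}(b/A)\}$ is a basic open set, where $\mathrm{qftp}(v/A)$ is the quantifier-free type of $v$ over $A$. $M$ is locally replicable if every non-empty open set in $M$ contains a copy of $M$. *)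

theory Defs
  imports "HOL-Analysis.Abstract_Topology" "HOL-Library.Countable_Set"
begin

text \<open>Symbols form a set rather than a whole type, so that the empty language is covered.\<close>

record 'r rel_language =
  symbols :: "'r set"
  arity :: "'r \<Rightarrow> nat"

record ('r, 'a) rel_struct =
  carrier :: "'a set"
  interp :: "'r \<Rightarrow> 'a list set"

definition is_structure :: "'r rel_language \<Rightarrow> ('r, 'a) rel_struct \<Rightarrow> bool" where
  "is_structure L M \<longleftrightarrow>
     (\<forall>r. \<forall>xs \<in> interp M r. r \<in> symbols L \<and> length xs = arity L r \<and> set xs \<subseteq> carrier M)"

definition induced :: "('r, 'a) rel_struct \<Rightarrow> 'a set \<Rightarrow> ('r, 'a) rel_struct" where
  "induced M S = \<lparr>carrier = S, interp = (\<lambda>r. {xs \<in> interp M r. set xs \<subseteq> S})\<rparr>"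

definition embedding ::
  "('r, 'a) rel_struct \<Rightarrow> ('r, 'b) rel_struct \<Rightarrow> ('a \<Rightarrow> 'b) \<Rightarrow> bool" where
  "embedding A B f \<longleftrightarrow>
     f ` carrier A \<subseteq> carrier B \<and> inj_on f (carrier A) \<and>
     (\<forall>r xs. set xs \<subseteq> carrier A \<longrightarrow> (xs \<in> interp A r \<longleftrightarrow> map f xs \<in> interp B r))"

definition isomorphism ::
  "('r, 'a) rel_struct \<Rightarrow> ('r, 'b) rel_struct \<Rightarrow> ('a \<Rightarrow> 'b) \<Rightarrow> bool" where
  "isomorphism A B f \<longleftrightarrow> embedding A B f \<and> f ` carrier A = carrier B"

definition isomorphic :: "('r, 'a) rel_struct \<Rightarrow> ('r, 'b) rel_struct \<Rightarrow> bool" where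
  "isomorphic A B \<longleftrightarrow> (\<exists>f. isomorphism A B f)"

definition ultrahomogeneous :: "('r, 'a) rel_struct \<Rightarrow> bool" where
  "ultrahomogeneous M \<longleftrightarrow>
     (\<forall>A B f. finite A \<and> A \<subseteq> carrier M \<and> finite B \<and> B \<subseteq> carrier M \<and>
        isomorphism (induced M A) (induced M B) f \<longrightarrow>
        (\<exists>g. isomorphism M M g \<and> (\<forall>x\<in>A. g x = f x)))"

definition relational_fraisse :: "'r rel_language \<Rightarrow> ('r, 'a) rel_struct \<Rightarrow> bool" where
  "relational_fraisse L M \<longleftrightarrow>
     is_structure L M \<and> countable (carrier M) \<and> infinite (carrier M) \<and> ultrahomogeneous M"

text \<open>The members of the age live on the type of \<open>M\<close> itself. When the carrier of \<open>M\<close>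
  is infinite, every finite structure has an isomorphic representative on this type.\<close>

definition age :: "'r rel_language \<Rightarrow> ('r, 'a) rel_struct \<Rightarrow> ('r, 'a) rel_struct set" where
  "age L M = {A. is_structure L A \<and> finite (carrier A) \<and> (\<exists>f. embedding A M f)}"

definition strong_amalgamation :: "'r rel_language \<Rightarrow> ('r, 'a) rel_struct \<Rightarrow> bool" where
  "strong_amalgamation L M \<longleftrightarrow>
     (\<forall>A \<in> age L M. \<forall>B0 \<in> age L M. \<forall>B1 \<in> age L M. \<forall>f0 f1.
        embedding A B0 f0 \<and> embedding A B1 f1 \<longrightarrow>
        (\<exists>C \<in> age L M. \<exists>g0 g1. embedding B0 C g0 \<and> embedding B1 C g1 \<and>
           (\<forall>x \<in> carrier A. g0 (f0 x) = g1 (f1 x)) \<and>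
           g0 ` carrier B0 \<inter> g1 ` carrier B1 = g0 ` f0 ` carrier A))"

definition is_copy :: "('r, 'a) rel_struct \<Rightarrow> 'a set \<Rightarrow> bool" where
  "is_copy M S \<longleftrightarrow> S \<subseteq> carrier M \<and> isomorphic (induced M S) M"

definition canonical_point_ramsey :: "('r, 'a) rel_struct \<Rightarrow> bool" where
  "canonical_point_ramsey M \<longleftrightarrow>
     (\<forall>\<chi> :: 'a \<Rightarrow> nat. \<exists>S. is_copy M S \<and> ((\<forall>x\<in>S. \<forall>y\<in>S. \<chi> x = \<chi> y) \<or> inj_on \<chi> S))"

definition galah :: "('r, 'a) rel_struct \<Rightarrow> bool" where
  "galah M \<longleftrightarrow>
     (\<forall>C D. C \<union> D = carrier M \<and> C \<inter> D = {} \<longrightarrow>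
        isomorphic (induced M C) M \<or> (\<exists>S \<subseteq> D. is_copy M S))"

text \<open>Quantifier-free formulas in one free variable, with parameters. The language being
  relational, the only terms are the variable and the parameters.\<close>

datatype 'a qf_term = Var | Param 'a

datatype ('r, 'a) qf_form =
    Bot
  | Eq "'a qf_term" "'a qf_term"
  | Rel 'r "'a qf_term list"
  | Neg "('r, 'a) qf_form"
  | Conj "('r, 'a) qf_form" "('r, 'a) qf_form"

primrec term_val :: "'a \<Rightarrow> 'a qf_term \<Rightarrow> 'a" where
  "term_val v Var = v"
| "term_val v (Param a) = a"

primrec sat :: "('r, 'a) rel_struct \<Rightarrow> 'a \<Rightarrow> ('r, 'a) qf_form \<Rightarrow> bool" where
  "sat M v Bot \<longleftrightarrow> False"
| "sat M v (Eq s t) \<longleftrightarrow> term_val v s = term_val v t"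
| "sat M v (Rel r ts) \<longleftrightarrow> map (term_val v) ts \<in> interp M r"
| "sat M v (Neg p) \<longleftrightarrow> \<not> sat M v p"
| "sat M v (Conj p q) \<longleftrightarrow> sat M v p \<and> sat M v q"

primrec formula_over :: "'r rel_language \<Rightarrow> 'a set \<Rightarrow> ('r, 'a) qf_form \<Rightarrow> bool" where
  "formula_over L A Bot \<longleftrightarrow> True"
| "formula_over L A (Eq s t) \<longleftrightarrow> set_qf_term s \<subseteq> A \<and> set_qf_term t \<subseteq> A"
| "formula_over L A (Rel r ts) \<longleftrightarrow>
     r \<in> symbols L \<and> length ts = arity L r \<and> (\<forall>t \<in> set ts. set_qf_term t \<subseteq> A)"
| "formula_over L A (Neg p) \<longleftrightarrow> formula_over L A p"
| "formula_over L A (Conj p q) \<longleftrightarrow> formula_over L A p \<and> formula_over L A q"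

definition qftp ::
  "'r rel_language \<Rightarrow> ('r, 'a) rel_struct \<Rightarrow> 'a set \<Rightarrow> 'a \<Rightarrow> ('r, 'a) qf_form set" where
  "qftp L M A v = {p. formula_over L A p \<and> sat M v p}"

definition type_topology :: "'r rel_language \<Rightarrow> ('r, 'a) rel_struct \<Rightarrow> 'a topology" where
  "type_topology L M = topology_generated_by
     {{v \<in> carrier M. qftp L M A v = qftp L M A b} | A b.
        finite A \<and> A \<subseteq> carrier M \<and> b \<in> carrier M - A}"

definition locally_replicable :: "'r rel_language \<Rightarrow> ('r, 'a) rel_struct \<Rightarrow> bool" where
  "locally_replicable L M \<longleftrightarrow>
     (\<forall>U. openin (type_topology L M) U \<and> U \<noteq> {} \<longrightarrow> (\<exists>S \<subseteq> U. is_copy M S))"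

end

theory Submission
  imports Defs "HOL-Analysis.Finite_Cartesian_Product"
begin

text \<open>For \<open>b\<close> outside a finite \<open>A\<close>, a point \<open>v\<close> has the
  type of \<open>b\<close> over \<open>A\<close> iff fixing \<open>A\<close> and sending
  \<open>b\<close> to \<open>v\<close> is an embedding. Every non-empty open set contains the
  realizations of such a type, so local replicability says that each of these sets contains a copy
  of \<open>M\<close>, that is, the image of a self-embedding.

  Galah and local replicability: the complement of the realization set \<open>U\<close> of a type
  over \<open>A\<close> contains \<open>A\<close> and omits the type, so it is not isomorphic to
  \<open>M\<close> (\<open>not_isomorphic_if_omits_type\<close>), and galah puts a copy into
  \<open>U\<close>. Conversely, for a partition \<open>(C, D)\<close>, either \<open>C\<close>
  realizes all types over its finite subsets and back-and-forth gives an isomorphism with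
  \<open>M\<close> (\<open>isomorphic_if_realizes_types\<close>), or some such type has all its
  realizations in \<open>D\<close>, which therefore contains a copy.

  From galah to the Ramsey property: galah implies indivisibility, so without monochromatic copies
  every copy shows infinitely many colours. As each type is realized on a whole copy, a finite
  heterochromatic partial embedding extends by a point of a fresh colour; the limit is a
  heterochromatic copy.

  From the Ramsey property to local replicability: strong amalgamation makes \<open>U\<close>
  infinite (\<open>infinite_realizations\<close>). A colouring built from the countably many
  translates of \<open>U\<close> excludes heterochromatic copies, and an automorphism carries a
  monochromatic one into \<open>U\<close>.\<close>

section \<open>Embeddings and copies\<close>

lemma carrier_induced [simp]: "carrier (induced M S) = S"
  by (simp add: induced_def)

lemma induced_induced: "T \<subseteq> S \<Longrightarrow> induced (induced M S) T = induced M T"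
  by (auto simp: induced_def fun_eq_iff)

lemma embedding_induced_iff:
  "embedding (induced M A) N f \<longleftrightarrow>
     f ` A \<subseteq> carrier N \<and> inj_on f A \<and>
     (\<forall>r xs. set xs \<subseteq> A \<longrightarrow> (xs \<in> interp M r \<longleftrightarrow> map f xs \<in> interp N r))"
proof -
  have "xs \<in> interp (induced M A) r \<longleftrightarrow> xs \<in> interp M r" if "set xs \<subseteq> A" for r xs
    using that by (simp add: induced_def)
  then show ?thesis
    unfolding embedding_def carrier_induced by blast
qed

text \<open>Interpretations may contain tuples leaving the carrier, so
  \<open>induced M (carrier M)\<close> need not equal \<open>M\<close>; an embedding only tests
  tuples inside its domain.\<close>

lemma embedding_induced_self:
  "embedding M N f \<longleftrightarrow> embedding (induced M (carrier M)) N f"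
  unfolding embedding_induced_iff by (simp only: embedding_def)

lemma embedding_into_induced_iff:
  "embedding M (induced N S) f \<longleftrightarrow> f ` carrier M \<subseteq> S \<and> inj_on f (carrier M) \<and>
     (\<forall>r xs. set xs \<subseteq> carrier M \<longrightarrow> (xs \<in> interp M r \<longleftrightarrow> map f xs \<in> interp N r))"
proof -
  have "map f xs \<in> interp (induced N S) r \<longleftrightarrow> map f xs \<in> interp N r \<and> f ` set xs \<subseteq> S" for r xs
    by (simp add: induced_def)
  then show ?thesis
    unfolding embedding_def carrier_induced by (smt (verit) image_mono order_trans)
qed

lemma embedding_into_induced:
  "S \<subseteq> carrier N \<Longrightarrow> embedding M (induced N S) f \<longleftrightarrow> embedding M N f \<and> f ` carrier M \<subseteq> S"
  unfolding embedding_into_induced_iff unfolding embedding_def by blast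

lemma embedding_cong:
  assumes "\<And>x. x \<in> carrier M \<Longrightarrow> f x = g x"
  shows "embedding M N f \<longleftrightarrow> embedding M N g"
proof -
  have "map f xs = map g xs" if "set xs \<subseteq> carrier M" for xs
    using that assms by auto
  moreover have "f ` carrier M = g ` carrier M" "inj_on f (carrier M) \<longleftrightarrow> inj_on g (carrier M)"
    using assms by (auto cong: inj_on_cong)
  ultimately show ?thesis
    unfolding embedding_def by metis
qed

lemma embedding_comp:
  assumes f: "embedding M N f" and g: "embedding N K g"
  shows "embedding M K (g \<circ> f)"
proof -
  have "inj_on (g \<circ> f) (carrier M)"
    using f g unfolding embedding_def by (meson comp_inj_on inj_on_subset)
  moreover have "(g \<circ> f) ` carrier M \<subseteq> carrier K"
    using f g unfolding embedding_def by auto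
  moreover have "xs \<in> interp M r \<longleftrightarrow> map (g \<circ> f) xs \<in> interp K r" if "set xs \<subseteq> carrier M" for r xs
  proof -
    have "set (map f xs) \<subseteq> carrier N"
      using that f unfolding embedding_def by auto
    then have "map f xs \<in> interp N r \<longleftrightarrow> map g (map f xs) \<in> interp K r"
      using g unfolding embedding_def by blast
    moreover have "xs \<in> interp M r \<longleftrightarrow> map f xs \<in> interp N r"
      using f that unfolding embedding_def by blast
    ultimately show ?thesis
      by simp
  qed
  ultimately show ?thesis
    unfolding embedding_def by blast
qed

lemma embedding_restrict:
  "embedding M N f \<Longrightarrow> A \<subseteq> carrier M \<Longrightarrow> embedding (induced M A) N f"
  unfolding embedding_induced_iff unfolding embedding_def
  by (intro conjI allI impI; elim conjE) (blast intro: inj_on_subset)+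

lemma embedding_induced_subset:
  "embedding (induced M B) N f \<Longrightarrow> A \<subseteq> B \<Longrightarrow> embedding (induced M A) N f"
  using embedding_restrict[of "induced M B" N f A] by (simp add: induced_induced)

lemma embedding_inclusion: "A \<subseteq> carrier M \<Longrightarrow> embedding (induced M A) M id"
  unfolding embedding_induced_iff by auto

lemma embedding_inverse:
  assumes "embedding M N f" and g: "\<And>x. x \<in> carrier M \<Longrightarrow> g (f x) = x"
  shows "embedding (induced N (f ` carrier M)) M g"
proof -
  have "ys \<in> interp N r \<longleftrightarrow> map g ys \<in> interp M r" if ys: "set ys \<subseteq> f ` carrier M" for r ys
  proof -
    have "set (map g ys) \<subseteq> carrier M" "map f (map g ys) = ys"
      using ys g by (auto intro!: map_idI)
    then show ?thesis
      using assms(1) unfolding embedding_def by metis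
  qed
  moreover have "inj_on g (f ` carrier M)" "g ` f ` carrier M \<subseteq> carrier M"
    using g by (auto simp: inj_on_def)
  ultimately show ?thesis
    unfolding embedding_induced_iff by blast
qed

lemma isomorphism_inverse:
  assumes "isomorphism M N f"
  obtains g where "isomorphism N M g" "\<And>x. x \<in> carrier M \<Longrightarrow> g (f x) = x"
    "\<And>y. y \<in> carrier N \<Longrightarrow> f (g y) = y"
proof
  let ?g = "inv_into (carrier M) f"
  have f: "embedding M N f" "f ` carrier M = carrier N" "inj_on f (carrier M)"
    using assms unfolding isomorphism_def embedding_def by auto
  show gf: "?g (f x) = x" if "x \<in> carrier M" for x
    using that f by simp
  show "f (?g y) = y" if "y \<in> carrier N" for y
    using that f by (metis f_inv_into_f)
  have "embedding N M ?g"
    using embedding_inverse[OF f(1) gf] f(2) embedding_induced_self by metis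
  moreover have "?g ` carrier N = carrier M"
    using f by (metis inv_into_image_cancel order_refl)
  ultimately show "isomorphism N M ?g"
    unfolding isomorphism_def by blast
qed

text \<open>Copies are handled through self-embeddings because these compose: an embedding
  transports a copy to a copy.\<close>

lemma is_copy_iff: "is_copy M S \<longleftrightarrow> (\<exists>k. embedding M M k \<and> k ` carrier M = S)"
proof
  assume S: "is_copy M S"
  then obtain f where "isomorphism (induced M S) M f" and SM: "S \<subseteq> carrier M"
    unfolding is_copy_def isomorphic_def by blast
  then obtain g where "isomorphism M (induced M S) g"
    using isomorphism_inverse by blast
  then show "\<exists>k. embedding M M k \<and> k ` carrier M = S"
    using embedding_into_induced[OF SM] unfolding isomorphism_def by auto
next
  assume "\<exists>k. embedding M M k \<and> k ` carrier M = S"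
  then obtain k where k: "embedding M M k" "k ` carrier M = S"
    by blast
  then have SM: "S \<subseteq> carrier M"
    unfolding embedding_def by blast
  have "isomorphism M (induced M S) k"
    using embedding_into_induced[OF SM] k unfolding isomorphism_def by auto
  then show "is_copy M S"
    using isomorphism_inverse SM unfolding is_copy_def isomorphic_def by metis
qed

lemma is_copy_image:
  assumes "is_copy M S" and g: "embedding M M g"
  shows "is_copy M (g ` S)"
proof -
  obtain k where "embedding M M k" "k ` carrier M = S"
    using assms(1) unfolding is_copy_iff by blast
  then show ?thesis
    using embedding_comp[of M M k M g] g unfolding is_copy_iff
    by (intro exI[of _ "g \<circ> k"]) auto
qed

lemma infinite_copy:
  "is_copy M S \<Longrightarrow> infinite (carrier M) \<Longrightarrow> infinite S"
  unfolding is_copy_iff embedding_def using finite_imageD by blast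

text \<open>Pulling \<open>X\<close> back along a self-embedding onto \<open>S\<close> partitions
  \<open>M\<close>, so galah applies; whichever part yields a copy, the embedding pushes it forward
  into \<open>X\<close> or \<open>Y\<close>.\<close>

lemma galah_indivisible:
  assumes "galah M" "is_copy M S" "S \<subseteq> X \<union> Y"
  shows "(\<exists>T\<subseteq>X. is_copy M T) \<or> (\<exists>T\<subseteq>Y. is_copy M T)"
proof -
  obtain k where k: "embedding M M k" "k ` carrier M = S"
    using assms(2) unfolding is_copy_iff by blast
  let ?C = "{x \<in> carrier M. k x \<in> X}"
  let ?D = "carrier M - ?C"
  have "?C \<union> ?D = carrier M" "?C \<inter> ?D = {}"
    by auto
  then have "isomorphic (induced M ?C) M \<or> (\<exists>T\<subseteq>?D. is_copy M T)"
    using assms(1) unfolding galah_def by blast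
  moreover have "is_copy M ?C \<longleftrightarrow> isomorphic (induced M ?C) M"
    unfolding is_copy_def by auto
  ultimately obtain T where T: "is_copy M T" "T = ?C \<or> T \<subseteq> ?D"
    by blast
  have "is_copy M (k ` T)"
    by (rule is_copy_image[OF T(1) k(1)])
  moreover have "k ` T \<subseteq> X \<or> k ` T \<subseteq> Y"
    using T(2) k(2) assms(3) by blast
  ultimately show ?thesis
    by blast
qed

lemma galah_finite_colours:
  fixes col :: "'a \<Rightarrow> 'c"
  assumes "galah M" "infinite (carrier M)" "finite F" "is_copy M S" "col ` S \<subseteq> F"
  shows "\<exists>T c. is_copy M T \<and> (\<forall>x\<in>T. col x = c)"
  using assms(3-5)
proof (induction F arbitrary: S rule: finite_induct)
  case empty
  then show ?case
    using infinite_copy[OF _ assms(2)] by auto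
next
  case (insert c F)
  have "S \<subseteq> {x. col x = c} \<union> {x. col x \<in> F}"
    using insert.prems by auto
  then consider T where "T \<subseteq> {x. col x = c}" "is_copy M T" | T where "T \<subseteq> {x. col x \<in> F}" "is_copy M T"
    using galah_indivisible[OF assms(1) insert.prems(1), of "{x. col x = c}" "{x. col x \<in> F}"] by blast
  then show ?case
  proof cases
    case 1
    then show ?thesis
      by blast
  next
    case 2
    then show ?thesis
      using insert.IH[of T] by blast
  qed
qed

section \<open>Limits of finite partial embeddings\<close>

text \<open>Being an embedding is a condition on finite sets of points, since tuples are finite, and
  a finite subset of an increasing union already lies in one stage.\<close>

lemma embedding_limit:
  fixes A :: "nat \<Rightarrow> 'a set" and f :: "nat \<Rightarrow> 'a \<Rightarrow> 'b"
  assumes emb: "\<And>n. embedding (induced M (A n)) N (f n)"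
    and A: "\<And>n. A n \<subseteq> A (Suc n)"
    and f: "\<And>n x. x \<in> A n \<Longrightarrow> f (Suc n) x = f n x"
  obtains g where "embedding (induced M (\<Union>n. A n)) N g" "\<And>n x. x \<in> A n \<Longrightarrow> g x = f n x"
proof
  define g where "g x = f (LEAST n. x \<in> A n) x" for x
  have mono: "A m \<subseteq> A n" if "m \<le> n" for m n
    using A that by (rule lift_Suc_mono_le)
  have stable: "f n x = f m x" if "m \<le> n" "x \<in> A m" for m n x
    using that(1)
  proof (induction n rule: dec_induct)
    case (step n)
    then show ?case
      using f[of x n] mono[of m n] that(2) by auto
  qed simp
  show g: "g x = f n x" if "x \<in> A n" for n x
    unfolding g_def using that stable[of "LEAST n. x \<in> A n" n x]
    by (metis LeastI Least_le)
  have common: "\<exists>n. X \<subseteq> A n" if "finite X" "X \<subseteq> (\<Union>n. A n)" for X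
    using that
  proof (induction X rule: finite_induct)
    case (insert x X)
    then obtain m n where "x \<in> A m" "X \<subseteq> A n"
      by auto
    then have "insert x X \<subseteq> A (max m n)"
      using mono[of m "max m n"] mono[of n "max m n"] by auto
    then show ?case ..
  qed simp
  show "embedding (induced M (\<Union>n. A n)) N g"
    unfolding embedding_induced_iff
  proof (intro conjI allI impI)
    show "g ` (\<Union>n. A n) \<subseteq> carrier N"
      using emb g unfolding embedding_induced_iff by fastforce
    show "inj_on g (\<Union>n. A n)"
    proof (rule inj_onI)
      fix x y assume xy: "x \<in> (\<Union>n. A n)" "y \<in> (\<Union>n. A n)" "g x = g y"
      then obtain n where "{x, y} \<subseteq> A n"
        using common[of "{x, y}"] by auto
      then show "x = y"
        using emb[of n] g[of x n] g[of y n] xy(3)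
        unfolding embedding_induced_iff by (auto dest: inj_onD)
    qed
    fix r and xs :: "'a list" assume "set xs \<subseteq> (\<Union>n. A n)"
    then obtain n where n: "set xs \<subseteq> A n"
      using common[of "set xs"] by auto
    then have "map g xs = map (f n) xs"
      using g by auto
    then show "xs \<in> interp M r \<longleftrightarrow> map g xs \<in> interp N r"
      using emb[of n] n unfolding embedding_induced_iff by metis
  qed
qed

text \<open>Dependent choice in the manner of Rasiowa-Sikorski: \<open>Q\<close> describes the
  admissible partial maps, and requirement \<open>E n\<close> is met in passing from stage
  \<open>n\<close> to stage \<open>Suc n\<close>. It serves both the back-and-forth and the
  construction of a heterochromatic copy.\<close>

lemma generic_embedding:
  fixes Q :: "'a set \<Rightarrow> ('a \<Rightarrow> 'b) \<Rightarrow> bool"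
  assumes init: "Q A0 f0"
    and emb: "\<And>A f. Q A f \<Longrightarrow> embedding (induced M A) N f"
    and dense: "\<And>n A f. Q A f \<Longrightarrow>
      \<exists>A' f'. A \<subseteq> A' \<and> (\<forall>x\<in>A. f' x = f x) \<and> Q A' f' \<and> E n A' f'"
  obtains A :: "nat \<Rightarrow> 'a set" and f g
  where "\<And>n. Q (A n) (f n)" "\<And>n. E n (A (Suc n)) (f (Suc n))" "\<And>n. A n \<subseteq> A (Suc n)"
    "embedding (induced M (\<Union>n. A n)) N g" "\<And>n x. x \<in> A n \<Longrightarrow> g x = f n x"
proof -
  define step where "step n p q \<longleftrightarrow>
    fst p \<subseteq> fst q \<and> (\<forall>x\<in>fst p. snd q x = snd p x) \<and> E n (fst q) (snd q)"
    for n :: nat and p q :: "'a set \<times> ('a \<Rightarrow> 'b)"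
  obtain p where p: "\<And>n. Q (fst (p n)) (snd (p n))" "\<And>n. step n (p n) (p (Suc n))"
  proof (rule exE[OF dependent_nat_choice[of "\<lambda>_ p. Q (fst p) (snd p)" step]])
    show "\<exists>p. Q (fst p) (snd p)"
      using init by auto
    show "\<exists>q. Q (fst q) (snd q) \<and> step n p q" if "Q (fst p) (snd p)" for p n
      using dense[OF that, of n] unfolding step_def by auto
  qed blast
  have A: "fst (p n) \<subseteq> fst (p (Suc n))" for n
    using p(2) unfolding step_def by blast
  have "snd (p (Suc n)) x = snd (p n) x" if "x \<in> fst (p n)" for n x
    using p(2) that unfolding step_def by blast
  with A obtain g where "embedding (induced M (\<Union>n. fst (p n))) N g"
    "\<And>n x. x \<in> fst (p n) \<Longrightarrow> g x = snd (p n) x"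
    using embedding_limit[of M "\<lambda>n. fst (p n)" N "\<lambda>n. snd (p n)"] emb[OF p(1)] by blast
  then show thesis
    using that[of "\<lambda>n. fst (p n)" "\<lambda>n. snd (p n)" g] p A unfolding step_def by blast
qed

section \<open>Realizations of types\<close>

text \<open>The realizations in \<open>M\<close> of the quantifier-free type of \<open>b\<close> over \<open>A\<close>, after its
  parameters have been moved by \<open>f\<close>.\<close>

definition realizations :: "('r, 'a) rel_struct \<Rightarrow> 'a set \<Rightarrow> 'a \<Rightarrow> ('a \<Rightarrow> 'a) \<Rightarrow> 'a set" where
  "realizations M A b f = {v \<in> carrier M. embedding (induced M (insert b A)) M (f(b := v))}"

lemma realizations_cong:
  "(\<And>x. x \<in> A \<Longrightarrow> f x = g x) \<Longrightarrow> realizations M A b f = realizations M A b g"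
  unfolding realizations_def by (intro Collect_cong conj_cong embedding_cong) auto

lemma realizations_disjoint:
  assumes "b \<notin> A"
  shows "realizations M A b f \<inter> f ` A = {}"
proof -
  have False if "v \<in> realizations M A b f" "a \<in> A" "v = f a" for v a
  proof -
    have "inj_on (f(b := v)) (insert b A)"
      using that(1) unfolding realizations_def embedding_induced_iff by blast
    from inj_onD[OF this, of b a] show False
      using that assms by auto
  qed
  then show ?thesis
    by blast
qed

lemma image_realizations:
  assumes "embedding M M g" "insert b A \<subseteq> carrier M"
  shows "g ` realizations M A b f \<subseteq> realizations M A b (g \<circ> f)"
proof -
  have "g v \<in> realizations M A b (g \<circ> f)" if "v \<in> realizations M A b f" for v
  proof -
    have "embedding (induced M (insert b A)) M (g \<circ> f(b := v))"
      using that assms(1) unfolding realizations_def by (blast intro: embedding_comp)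
    moreover have "g \<circ> f(b := v) = (g \<circ> f)(b := g v)"
      by auto
    ultimately show ?thesis
      using that assms(1) unfolding realizations_def embedding_def by auto
  qed
  then show ?thesis
    by blast
qed

lemma image_mem_realizations:
  assumes "embedding M M g" "insert b A \<subseteq> carrier M"
  shows "g b \<in> realizations M A b g"
proof -
  have "g(b := g b) = g"
    by auto
  then show ?thesis
    using embedding_restrict[OF assms] assms unfolding realizations_def embedding_def by auto
qed

text \<open>Quantifier-free formulas are Boolean combinations of atoms: the equality atoms account
  for injectivity of \<open>id(b := v)\<close> on \<open>insert b A\<close>, the relational atoms
  for the rest of the embedding condition.\<close>

lemma qftp_eq_iff:
  assumes L: "is_structure L M" and A: "A \<subseteq> carrier M" and b: "b \<in> carrier M - A"
    and v: "v \<in> carrier M"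
  shows "qftp L M A v = qftp L M A b \<longleftrightarrow> v \<in> realizations M A b id"
proof
  assume eq: "qftp L M A v = qftp L M A b"
  have sat: "sat M v p \<longleftrightarrow> sat M b p" if "formula_over L A p" for p
    using eq that unfolding qftp_def by blast
  have "v \<notin> A"
    using sat[of "Eq Var (Param v)"] b by auto
  then have "inj_on (id(b := v)) (insert b A)"
    by (auto simp: inj_on_def)
  moreover have "xs \<in> interp M r \<longleftrightarrow> map (id(b := v)) xs \<in> interp M r"
    if xs: "set xs \<subseteq> insert b A" for r xs
  proof (cases "r \<in> symbols L \<and> length xs = arity L r")
    case True
    \<comment> \<open>The tuple \<open>xs\<close> becomes an atom by writing the variable for
      \<open>b\<close>; it evaluates back to \<open>xs\<close> at \<open>b\<close> and to the moved
      tuple at \<open>v\<close>.\<close>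
    let ?ts = "map (\<lambda>x. if x = b then Var else Param x) xs"
    have "formula_over L A (Rel r ?ts)"
      using True xs by auto
    moreover have "map (term_val v) ?ts = map (id(b := v)) xs" "map (term_val b) ?ts = xs"
      by (auto intro!: map_idI)
    ultimately show ?thesis
      using sat[of "Rel r ?ts"] by (simp only: sat.simps)
  next
    case False
    then show ?thesis
      using L unfolding is_structure_def by (metis length_map)
  qed
  ultimately show "v \<in> realizations M A b id"
    using A v unfolding realizations_def embedding_induced_iff by auto
next
  assume "v \<in> realizations M A b id"
  then have emb: "embedding (induced M (insert b A)) M (id(b := v))"
    unfolding realizations_def by blast
  have val: "term_val v t = (id(b := v)) (term_val b t)" "term_val b t \<in> insert b A"
    if "set_qf_term t \<subseteq> A" for t
    using that b by (cases t; auto)+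
  have "sat M v p \<longleftrightarrow> sat M b p" if "formula_over L A p" for p
    using that
  proof (induction p)
    case (Eq s t)
    have inj: "inj_on (id(b := v)) (insert b A)"
      using emb unfolding embedding_induced_iff by blast
    have s: "set_qf_term s \<subseteq> A" and t: "set_qf_term t \<subseteq> A"
      using Eq by auto
    show ?case
      unfolding sat.simps val(1)[OF s] val(1)[OF t]
      using inj val(2)[OF s] val(2)[OF t] by (rule inj_on_eq_iff)
  next
    case (Rel r ts)
    then have "map (term_val v) ts = map (id(b := v)) (map (term_val b) ts)"
      using val(1) by auto
    moreover have "set (map (term_val b) ts) \<subseteq> insert b A"
      using Rel val(2) by auto
    ultimately show ?case
      using emb unfolding embedding_induced_iff by (simp only: sat.simps)
  qed auto
  then show "qftp L M A v = qftp L M A b"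
    unfolding qftp_def by blast
qed

lemma realizations_id_sym:
  assumes "is_structure L M" "A \<subseteq> carrier M" "b \<in> carrier M - A" "v \<in> realizations M A b id"
  shows "b \<in> realizations M A v id"
proof -
  have v: "v \<in> carrier M - A"
    using assms(3,4) realizations_disjoint[of b A M id] unfolding realizations_def by auto
  then have "qftp L M A b = qftp L M A v"
    using qftp_eq_iff[of L M A b v] assms by auto
  then show ?thesis
    using qftp_eq_iff[of L M A v b] v assms by auto
qed

text \<open>The sets generating the topology are taken as a subbasis. Intersections cause no harm,
  since the type of \<open>x\<close> over a union of two parameter sets refines its types over
  both.\<close>

lemma open_contains_realizations:
  assumes L: "is_structure L M" and U: "openin (type_topology L M) U" and x: "x \<in> U"
  shows "\<exists>A. finite A \<and> A \<subseteq> carrier M \<and> x \<in> carrier M - A \<and> realizations M A x id \<subseteq> U"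
proof -
  define B where "B = {{v \<in> carrier M. qftp L M A v = qftp L M A b} | A b.
    finite A \<and> A \<subseteq> carrier M \<and> b \<in> carrier M - A}"
  have "generate_topology_on B U"
    using U unfolding type_topology_def B_def by (simp add: openin_topology_generated_by_iff)
  then show ?thesis
    using x
  proof (induction arbitrary: x rule: generate_topology_on.induct)
    case Empty
    then show ?case
      by simp
  next
    case (Int V W)
    then obtain A A' where
      A: "finite A" "A \<subseteq> carrier M" "x \<in> carrier M - A" "realizations M A x id \<subseteq> V" and
      A': "finite A'" "A' \<subseteq> carrier M" "x \<in> carrier M - A'" "realizations M A' x id \<subseteq> W"
      by (meson IntD1 IntD2)
    have "realizations M (A \<union> A') x id \<subseteq> realizations M A x id \<inter> realizations M A' x id"
      unfolding realizations_def by (auto elim!: embedding_induced_subset)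
    then have "realizations M (A \<union> A') x id \<subseteq> V \<inter> W"
      using A A' by blast
    then show ?case
      using A A' by (intro exI[of _ "A \<union> A'"] conjI) blast+
  next
    case (UN K)
    then show ?case
      by (metis Union_iff Union_upper order_trans)
  next
    case (Basis V)
    then obtain A b where V: "V = {v \<in> carrier M. qftp L M A v = qftp L M A b}"
      and A: "finite A" "A \<subseteq> carrier M" "b \<in> carrier M - A"
      unfolding B_def by blast
    have x: "x \<in> carrier M" "qftp L M A x = qftp L M A b"
      using Basis V by auto
    \<comment> \<open>\<open>x\<close> and \<open>b\<close> have the same type over
      \<open>A\<close>, so the neighbourhood can be recentred at \<open>x\<close>.\<close>
    then have "x \<in> realizations M A b id"
      using qftp_eq_iff[OF L A(2,3)] by blast
    then have xA: "x \<in> carrier M - A"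
      using realizations_disjoint[of b A M id] A x by auto
    have "realizations M A x id \<subseteq> V"
      using qftp_eq_iff[OF L A(2) xA] x V unfolding realizations_def by auto
    then show ?case
      using A xA by blast
  qed
qed

text \<open>A set of realizations is open and contains the \<open>b\<close> that defines it; every
  non-empty open set contains such a set. This removes formulas and topology from the rest of the
  argument.\<close>

lemma locally_replicable_iff:
  assumes L: "is_structure L M"
  shows "locally_replicable L M \<longleftrightarrow>
    (\<forall>A b. finite A \<and> A \<subseteq> carrier M \<and> b \<in> carrier M - A \<longrightarrow>
       (\<exists>S \<subseteq> realizations M A b id. is_copy M S))" (is "_ \<longleftrightarrow> ?R")
proof
  assume lr: "locally_replicable L M"
  show ?R
  proof (intro allI impI)
    fix A b assume A: "finite A \<and> A \<subseteq> carrier M \<and> b \<in> carrier M - A"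
    have eq: "{v \<in> carrier M. qftp L M A v = qftp L M A b} = realizations M A b id"
      using qftp_eq_iff[OF L] A unfolding realizations_def by blast
    then have "openin (type_topology L M) (realizations M A b id)"
      using A unfolding type_topology_def by (intro topology_generated_by_Basis) blast
    moreover have "realizations M A b id \<noteq> {}"
      using eq A by auto
    ultimately show "\<exists>S \<subseteq> realizations M A b id. is_copy M S"
      using lr unfolding locally_replicable_def by blast
  qed
next
  assume ?R
  then show "locally_replicable L M"
    using open_contains_realizations[OF L] unfolding locally_replicable_def
    by (meson all_not_in_conv order_trans)
qed

section \<open>Ultrahomogeneous structures\<close>

lemma ultrahomogeneous_extend:
  assumes "ultrahomogeneous M" "finite A" "A \<subseteq> carrier M" "embedding (induced M A) M f"
  obtains g where "isomorphism M M g" "\<And>x. x \<in> A \<Longrightarrow> g x = f x"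
proof -
  have fA: "f ` A \<subseteq> carrier M"
    using assms(4) unfolding embedding_induced_iff by blast
  then have "isomorphism (induced M A) (induced M (f ` A)) f"
    using assms(4) unfolding isomorphism_def embedding_into_induced[OF fA] by simp
  then show thesis
    using assms(1-3) fA that unfolding ultrahomogeneous_def by (metis finite_imageI)
qed

text \<open>Back-and-forth between \<open>C\<close> and \<open>M\<close>. Finite partial maps extend
  to new points of \<open>C\<close> by ultrahomogeneity of \<open>M\<close>; reaching a new point of
  \<open>M\<close> from a point of \<open>C\<close> is where \<open>types\<close> enters.\<close>

lemma isomorphic_if_realizes_types:
  fixes M :: "('r, 'a) rel_struct"
  assumes L: "is_structure L M" and cnt: "countable (carrier M)" and hom: "ultrahomogeneous M"
    and ne: "carrier M \<noteq> {}" and C: "C \<subseteq> carrier M"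
    and types: "\<And>A b. finite A \<Longrightarrow> A \<subseteq> C \<Longrightarrow> b \<in> carrier M - A \<Longrightarrow> realizations M A b id \<inter> C \<noteq> {}"
  shows "isomorphic (induced M C) M"
proof -
  define Q where "Q A f \<longleftrightarrow> finite A \<and> A \<subseteq> C \<and> embedding (induced M A) M f" for A f
  define E where "E n A f \<longleftrightarrow> from_nat_into C n \<in> A \<and> from_nat_into (carrier M) n \<in> f ` A"
    for n A and f :: "'a \<Rightarrow> 'a"
  have Cne: "C \<noteq> {}"
    using types[of "{}"] ne by auto
  have forward: "\<exists>A' f'. A \<subseteq> A' \<and> (\<forall>x\<in>A. f' x = f x) \<and> Q A' f' \<and> c \<in> A'"
    if Q: "Q A f" and c: "c \<in> C" for A f c
  proof -
    obtain g where "isomorphism M M g" and gf: "\<And>x. x \<in> A \<Longrightarrow> g x = f x"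
      using ultrahomogeneous_extend[OF hom, of A f] Q C unfolding Q_def by blast
    then have "Q (insert c A) g"
      using embedding_restrict[of M M g "insert c A"] Q c C
      unfolding Q_def isomorphism_def by blast
    then show ?thesis
      using gf by blast
  qed
  have backward: "\<exists>A' f'. A \<subseteq> A' \<and> (\<forall>x\<in>A. f' x = f x) \<and> Q A' f' \<and> d \<in> f' ` A'"
    if Q: "Q A f" and d: "d \<in> carrier M" for A f d
  proof (cases "d \<in> f ` A")
    case True
    then show ?thesis
      using Q by blast
  next
    case False
    have A: "finite A" "A \<subseteq> C" "A \<subseteq> carrier M"
      using Q C unfolding Q_def by auto
    obtain g where g: "isomorphism M M g" and gf: "\<And>x. x \<in> A \<Longrightarrow> g x = f x"
      using ultrahomogeneous_extend[OF hom, of A f] Q C unfolding Q_def by blast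
    \<comment> \<open>Pull \<open>d\<close> back to \<open>v\<close> along an automorphism extending
      \<open>f\<close> and trade \<open>v\<close> for a point \<open>c\<close> of \<open>C\<close>
      with the same type over \<open>A\<close>: sending \<open>c\<close> to \<open>d\<close> extends
      \<open>f\<close>.\<close>
    have "d \<in> g ` carrier M"
      using g d unfolding isomorphism_def by simp
    then obtain v where v: "v \<in> carrier M" "g v = d"
      by blast
    have vA: "v \<in> carrier M - A"
      using False v gf by auto
    then obtain c where c: "c \<in> C" "c \<in> realizations M A v id"
      using types[OF A(1,2)] by blast
    then have "v \<in> realizations M A c id"
      using realizations_id_sym[OF L A(3) vA] by blast
    moreover have "embedding M M g"
      using g unfolding isomorphism_def by blast
    moreover have "insert c A \<subseteq> carrier M"
      using c(1) C A(3) by blast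
    ultimately have "g v \<in> realizations M A c (g \<circ> id)"
      using image_realizations[of M g c A id] by blast
    then have "embedding (induced M (insert c A)) M (g(c := d))"
      using v unfolding realizations_def by simp
    then have "Q (insert c A) (g(c := d))"
      using A c unfolding Q_def by auto
    moreover have "c \<notin> A"
      using c(2) realizations_disjoint[of v A M id] vA by auto
    ultimately show ?thesis
      using gf by (intro exI[of _ "insert c A"] exI[of _ "g(c := d)"]) auto
  qed
  have dense: "\<exists>A' f'. A \<subseteq> A' \<and> (\<forall>x\<in>A. f' x = f x) \<and> Q A' f' \<and> E n A' f'"
    if Q: "Q A f" for n A f
  proof -
    obtain A1 f1 where 1: "A \<subseteq> A1" "\<forall>x\<in>A. f1 x = f x" "Q A1 f1" "from_nat_into C n \<in> A1"
      using forward[OF Q from_nat_into[OF Cne, of n]] by blast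
    obtain A2 f2 where 2: "A1 \<subseteq> A2" "\<forall>x\<in>A1. f2 x = f1 x" "Q A2 f2"
      "from_nat_into (carrier M) n \<in> f2 ` A2"
      using backward[OF 1(3) from_nat_into[OF ne, of n]] by blast
    have "A \<subseteq> A2" "\<forall>x\<in>A. f2 x = f x" "E n A2 f2"
      using 1 2 unfolding E_def by auto
    then show ?thesis
      using 2(3) by blast
  qed
  have init: "Q {} id"
    unfolding Q_def using embedding_inclusion[of "{}" M] by simp
  have emb: "embedding (induced M A) M f" if "Q A f" for A f
    using that unfolding Q_def by blast
  obtain A :: "nat \<Rightarrow> 'a set" and f g where QA: "\<And>n. Q (A n) (f n)"
    and EA: "\<And>n. E n (A (Suc n)) (f (Suc n))" and mono: "\<And>n. A n \<subseteq> A (Suc n)"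
    and g: "embedding (induced M (\<Union>n. A n)) M g" and gf: "\<And>n x. x \<in> A n \<Longrightarrow> g x = f n x"
    using generic_embedding[of Q "{}" id M M E, OF init emb dense] by metis
  have "c \<in> (\<Union>n. A n)" if "c \<in> C" for c
    using EA from_nat_into_surj[OF countable_subset[OF C cnt] that] unfolding E_def by blast
  then have UA: "(\<Union>n. A n) = C"
    using QA unfolding Q_def by blast
  have "d \<in> g ` C" if d: "d \<in> carrier M" for d
  proof -
    obtain n where "d \<in> f (Suc n) ` A (Suc n)"
      using EA from_nat_into_surj[OF cnt d] unfolding E_def by blast
    then obtain c where "c \<in> A (Suc n)" "d = f (Suc n) c"
      by blast
    then have "g c = d" "c \<in> C"
      using gf UA by auto
    then show ?thesis
      by blast
  qed
  then have "isomorphism (induced M C) M g"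
    using g UA unfolding isomorphism_def embedding_induced_iff by auto
  then show ?thesis
    unfolding isomorphic_def by blast
qed

text \<open>An isomorphism between \<open>C\<close> and \<open>M\<close>, corrected by an
  automorphism of \<open>M\<close>, yields a self-embedding with values in \<open>C\<close> that
  fixes \<open>A\<close> pointwise; the image of \<open>b\<close> would realize the omitted type in
  \<open>C\<close>.\<close>

lemma not_isomorphic_if_omits_type:
  assumes hom: "ultrahomogeneous M" and A: "finite A" "A \<subseteq> C" and C: "C \<subseteq> carrier M"
    and b: "b \<in> carrier M" and omit: "realizations M A b id \<inter> C = {}"
  shows "\<not> isomorphic (induced M C) M"
proof
  assume "isomorphic (induced M C) M"
  then obtain k where k: "isomorphism (induced M C) M k"
    unfolding isomorphic_def by blast
  obtain h where h: "isomorphism M (induced M C) h" "\<And>x. x \<in> C \<Longrightarrow> h (k x) = x"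
    using isomorphism_inverse[OF k] by (metis carrier_induced)
  have "embedding (induced M A) M k"
    using k A embedding_induced_subset unfolding isomorphism_def by blast
  then obtain g where g: "isomorphism M M g" "\<And>x. x \<in> A \<Longrightarrow> g x = k x"
    using ultrahomogeneous_extend[OF hom, of A k] A C by blast
  have "embedding M M (h \<circ> g)"
    using g h C embedding_comp embedding_into_induced unfolding isomorphism_def by metis
  then have "(h \<circ> g) b \<in> realizations M A b (h \<circ> g)"
    using A C b by (intro image_mem_realizations) blast+
  also have "realizations M A b (h \<circ> g) = realizations M A b id"
    using g h A by (intro realizations_cong) auto
  finally have "h (g b) \<in> realizations M A b id"
    by simp
  moreover have "h (g b) \<in> C"
    using g(1) h(1) b unfolding isomorphism_def by auto
  ultimately show False
    using omit by blast
qed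

text \<open>Amalgamating \<open>A \<union> U\<close> with \<open>A \<union> {b}\<close> over \<open>A\<close>, where \<open>U\<close> is a finite set of
  realizations, produces a realization outside \<open>U\<close>.\<close>

lemma infinite_realizations:
  assumes L: "is_structure L M" and hom: "ultrahomogeneous M" and sap: "strong_amalgamation L M"
    and A: "finite A" "A \<subseteq> carrier M" and b: "b \<in> carrier M - A"
  shows "infinite (realizations M A b id)"
proof
  let ?U = "realizations M A b id"
  let ?B = "A \<union> ?U"
  assume fin: "finite ?U"
  have UM: "?B \<subseteq> carrier M"
    using A unfolding realizations_def by blast
  have age: "induced M X \<in> age L M" if "finite X" "X \<subseteq> carrier M" for X
    using L that embedding_inclusion[OF that(2)] unfolding age_def
    by (auto simp: is_structure_def induced_def)
  have inc: "embedding (induced M A) (induced M X) id" if "A \<subseteq> X" "X \<subseteq> carrier M" for X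
    using embedding_inclusion[OF A(2)] that(1) unfolding embedding_into_induced[OF that(2)] by simp
  obtain C g0 g1 where C: "C \<in> age L M" and g0: "embedding (induced M ?B) C g0"
    and g1: "embedding (induced M (insert b A)) C g1" and agree: "\<forall>x\<in>A. g0 x = g1 x"
    and meet: "g0 ` ?B \<inter> g1 ` insert b A = g0 ` A"
  proof -
    have "\<exists>C \<in> age L M. \<exists>g0 g1. embedding (induced M ?B) C g0 \<and>
        embedding (induced M (insert b A)) C g1 \<and>
        (\<forall>x \<in> carrier (induced M A). g0 (id x) = g1 (id x)) \<and>
        g0 ` carrier (induced M ?B) \<inter> g1 ` carrier (induced M (insert b A)) =
          g0 ` id ` carrier (induced M A)"
      using sap age[of A] age[of ?B] age[of "insert b A"] inc[of ?B] inc[of "insert b A"] A b fin UM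
      unfolding strong_amalgamation_def by blast
    then show thesis
      using that by auto
  qed
  obtain h where h: "embedding C M h"
    using C unfolding age_def by blast
  \<comment> \<open>The amalgam sits in \<open>M\<close> through \<open>h\<close>; the inverse
    \<open>s\<close> of \<open>g\<close> moves it so that every point of \<open>?B\<close> returns
    to its place. Hence \<open>?k\<close> fixes \<open>A\<close> and sends \<open>b\<close> to a
    realization.\<close>
  obtain g where g: "isomorphism M M g" "\<And>x. x \<in> ?B \<Longrightarrow> g x = (h \<circ> g0) x"
    using ultrahomogeneous_extend[OF hom _ UM embedding_comp[OF g0 h]] A fin by blast
  obtain s where s: "isomorphism M M s" "\<And>x. x \<in> carrier M \<Longrightarrow> s (g x) = x"
    using isomorphism_inverse[OF g(1)] by metis
  let ?k = "s \<circ> (h \<circ> g1)"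
  have s_inv: "s (h (g0 x)) = x" if "x \<in> ?B" for x
    using that g(2) s(2) UM by (metis comp_apply subsetD)
  have k: "embedding (induced M (insert b A)) M ?k"
    using embedding_comp[OF embedding_comp[OF g1 h]] s(1) unfolding isomorphism_def by blast
  moreover have "embedding (induced M (insert b A)) M ?k \<longleftrightarrow>
      embedding (induced M (insert b A)) M (id(b := ?k b))"
    using s_inv agree b by (intro embedding_cong) (auto, metis)
  moreover have "?k b \<in> carrier M"
    using k unfolding embedding_induced_iff by blast
  ultimately have kU: "?k b \<in> ?U"
    unfolding realizations_def by blast
  \<comment> \<open>Both \<open>g0 (?k b)\<close> and \<open>g1 b\<close> land on
    \<open>?k b\<close>, so they coincide in \<open>C\<close>; by \<open>meet\<close> this point
    comes from \<open>A\<close>, against injectivity of \<open>g1\<close>.\<close>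
  then have same: "(s \<circ> h) (g0 (?k b)) = (s \<circ> h) (g1 b)"
    using s_inv by simp
  have inj: "inj_on (s \<circ> h) (carrier C)"
    using embedding_comp[OF h, of M s] s(1) unfolding isomorphism_def embedding_def by blast
  have "g0 (?k b) \<in> carrier C" "g1 b \<in> carrier C"
    using g0 g1 kU unfolding embedding_induced_iff by auto
  then have eq: "g0 (?k b) = g1 b"
    by (rule inj_onD[OF inj same])
  have "g0 (?k b) \<in> g0 ` ?B"
    using kU by blast
  then have "g1 b \<in> g0 ` ?B \<inter> g1 ` insert b A"
    unfolding eq by blast
  then have "g1 b \<in> g0 ` A"
    unfolding meet .
  then obtain a where "a \<in> A" "g1 b = g1 a"
    using agree by auto
  moreover have "inj_on g1 (insert b A)"
    using g1 unfolding embedding_induced_iff by blast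
  ultimately show False
    using b by (auto dest: inj_onD)
qed

section \<open>The equivalences\<close>

lemma galah_imp_locally_replicable:
  assumes "relational_fraisse L M" "galah M"
  shows "locally_replicable L M"
proof -
  have L: "is_structure L M" and hom: "ultrahomogeneous M"
    using assms(1) unfolding relational_fraisse_def by auto
  have "\<exists>S \<subseteq> realizations M A b id. is_copy M S"
    if A: "finite A" "A \<subseteq> carrier M" "b \<in> carrier M - A" for A b
  proof -
    let ?U = "realizations M A b id"
    \<comment> \<open>A realization never lies in the parameter set, so the complement of
      \<open>?U\<close> keeps \<open>A\<close> while omitting the type.\<close>
    have "A \<subseteq> carrier M - ?U"
      using realizations_disjoint[of b A M id] A by auto
    then have "\<not> isomorphic (induced M (carrier M - ?U)) M"
      using A by (intro not_isomorphic_if_omits_type[OF hom, of A _ b]) auto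
    moreover have "(carrier M - ?U) \<union> ?U = carrier M"
      unfolding realizations_def by blast
    ultimately show ?thesis
      using assms(2) unfolding galah_def by blast
  qed
  then show ?thesis
    unfolding locally_replicable_iff[OF L] by blast
qed

lemma locally_replicable_imp_galah:
  assumes "relational_fraisse L M" "locally_replicable L M"
  shows "galah M"
  unfolding galah_def
proof (intro allI impI)
  fix C D assume CD: "C \<union> D = carrier M \<and> C \<inter> D = {}"
  have L: "is_structure L M" and M: "countable (carrier M)" "ultrahomogeneous M" "carrier M \<noteq> {}"
    using assms(1) unfolding relational_fraisse_def by auto
  show "isomorphic (induced M C) M \<or> (\<exists>S \<subseteq> D. is_copy M S)"
  \<comment> \<open>Either some type over a finite subset of \<open>C\<close> has no realization in
    \<open>C\<close>, hence all of them in \<open>D\<close>, or \<open>C\<close> is rich enough for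
    the back-and-forth.\<close>
  proof (cases "\<exists>A b. finite A \<and> A \<subseteq> C \<and> b \<in> carrier M - A \<and> realizations M A b id \<inter> C = {}")
    case True
    then obtain A b where A: "finite A" "A \<subseteq> C" "b \<in> carrier M - A" "realizations M A b id \<inter> C = {}"
      by blast
    then have "realizations M A b id \<subseteq> D"
      using CD unfolding realizations_def by blast
    moreover have "A \<subseteq> carrier M"
      using A(2) CD by blast
    then have "\<exists>S \<subseteq> realizations M A b id. is_copy M S"
      using assms(2) A(1,3) unfolding locally_replicable_iff[OF L] by blast
    ultimately show ?thesis
      by blast
  next
    case False
    then show ?thesis
      using isomorphic_if_realizes_types[OF L M, of C] CD by blast
  qed
qed

lemma galah_imp_canonical_point_ramsey:
  fixes M :: "('r, 'a) rel_struct"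
  assumes "relational_fraisse L M" "galah M"
  shows "canonical_point_ramsey M"
  unfolding canonical_point_ramsey_def
proof (rule allI, rule ccontr)
  fix col :: "'a \<Rightarrow> nat"
  assume no: "\<nexists>S. is_copy M S \<and> ((\<forall>x\<in>S. \<forall>y\<in>S. col x = col y) \<or> inj_on col S)"
  have L: "is_structure L M" and cnt: "countable (carrier M)" and inf: "infinite (carrier M)"
    and hom: "ultrahomogeneous M"
    using assms(1) unfolding relational_fraisse_def by auto
  have ne: "carrier M \<noteq> {}"
    using inf by auto
  define Q where "Q A f \<longleftrightarrow>
    finite A \<and> A \<subseteq> carrier M \<and> embedding (induced M A) M f \<and> inj_on (col \<circ> f) A" for A f
  \<comment> \<open>The only requirement is that the domains exhaust \<open>M\<close>; the image of
    the limit is the copy.\<close>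
  define E where "E n A f \<longleftrightarrow> from_nat_into (carrier M) n \<in> A" for n A and f :: "'a \<Rightarrow> 'a"
  have dense: "\<exists>A' f'. A \<subseteq> A' \<and> (\<forall>x\<in>A. f' x = f x) \<and> Q A' f' \<and> E n A' f'"
    if Q: "Q A f" for n A f
  proof (cases "from_nat_into (carrier M) n \<in> A")
    case True
    then show ?thesis
      using Q unfolding E_def by blast
  next
    case False
    define b where "b = from_nat_into (carrier M) n"
    have b: "b \<in> carrier M - A"
      using False from_nat_into[OF ne] unfolding b_def by blast
    have A: "finite A" "A \<subseteq> carrier M" "embedding (induced M A) M f" "inj_on (col \<circ> f) A"
      using Q unfolding Q_def by auto
    obtain g where g: "isomorphism M M g" and gf: "\<And>x. x \<in> A \<Longrightarrow> g x = f x"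
      using ultrahomogeneous_extend[OF hom A(1-3)] by blast
    obtain S where S: "S \<subseteq> realizations M A b id" "is_copy M S"
      using galah_imp_locally_replicable[OF assms] A b unfolding locally_replicable_iff[OF L]
      by blast
    have "is_copy M (g ` S)"
      using g S(2) is_copy_image unfolding isomorphism_def by blast
    moreover have "\<nexists>T c. is_copy M T \<and> (\<forall>x\<in>T. col x = c)"
      using no by metis
    \<comment> \<open>Otherwise the image of \<open>S\<close> under \<open>g\<close> would be a copy
      using only the finitely many colours already taken, and would contain a monochromatic
      one.\<close>
    ultimately have "\<not> col ` g ` S \<subseteq> (col \<circ> f) ` A"
      using galah_finite_colours[OF assms(2) inf, of "(col \<circ> f) ` A" "g ` S" col] A(1) by blast
    moreover have "g ` S \<subseteq> realizations M A b f"
    proof -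
      have "g ` S \<subseteq> g ` realizations M A b id"
        using S(1) by blast
      also have "\<dots> \<subseteq> realizations M A b (g \<circ> id)"
        using g A(2) b unfolding isomorphism_def by (intro image_realizations) blast+
      also have "\<dots> = realizations M A b f"
        using gf by (intro realizations_cong) simp
      finally show ?thesis .
    qed
    ultimately obtain v where v: "v \<in> realizations M A b f" "col v \<notin> (col \<circ> f) ` A"
      by blast
    have "inj_on (col \<circ> f(b := v)) A \<longleftrightarrow> inj_on (col \<circ> f) A"
      using b by (intro inj_on_cong) auto
    moreover have "(col \<circ> f(b := v)) ` A = (col \<circ> f) ` A"
      using b by (intro image_cong) auto
    ultimately have "inj_on (col \<circ> f(b := v)) (insert b A)"
      using v(2) A(4) b by simp
    then have "Q (insert b A) (f(b := v))"
      using v(1) A b unfolding Q_def realizations_def by blast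
    then show ?thesis
      using b unfolding E_def b_def[symmetric]
      by (intro exI[of _ "insert b A"] exI[of _ "f(b := v)"]) auto
  qed
  have init: "Q {} id"
    unfolding Q_def using embedding_inclusion[of "{}" M] by simp
  have emb: "embedding (induced M A) M f" if "Q A f" for A f
    using that unfolding Q_def by blast
  obtain A :: "nat \<Rightarrow> 'a set" and f g where QA: "\<And>n. Q (A n) (f n)"
    and EA: "\<And>n. E n (A (Suc n)) (f (Suc n))" and mono: "\<And>n. A n \<subseteq> A (Suc n)"
    and g: "embedding (induced M (\<Union>n. A n)) M g" and gf: "\<And>n x. x \<in> A n \<Longrightarrow> g x = f n x"
    using generic_embedding[of Q "{}" id M M E, OF init emb dense] by metis
  have "c \<in> (\<Union>n. A n)" if "c \<in> carrier M" for c
    using EA from_nat_into_surj[OF cnt that] unfolding E_def by blast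
  then have UA: "(\<Union>n. A n) = carrier M"
    using QA unfolding Q_def by blast
  have "inj_on (col \<circ> g) (\<Union>n. A n)"
  proof (rule inj_onI)
    fix x y assume xy: "x \<in> (\<Union>n. A n)" "y \<in> (\<Union>n. A n)" "(col \<circ> g) x = (col \<circ> g) y"
    then obtain m n where "x \<in> A m" "y \<in> A n"
      by blast
    then have max: "x \<in> A (max m n)" "y \<in> A (max m n)"
      using lift_Suc_mono_le[of A, OF mono] by (meson max.cobounded1 max.cobounded2 subsetD)+
    have inj: "inj_on (col \<circ> f (max m n)) (A (max m n))"
      using QA unfolding Q_def by blast
    have "(col \<circ> f (max m n)) x = (col \<circ> f (max m n)) y"
      using gf[OF max(1)] gf[OF max(2)] xy(3) by simp
    then show "x = y"
      using max by (rule inj_onD[OF inj])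
  qed
  then have "inj_on col (g ` carrier M)"
    using UA by (metis inj_on_imageI)
  moreover have "is_copy M (g ` carrier M)"
    using g UA embedding_induced_self is_copy_iff by metis
  ultimately show False
    using no by blast
qed

text \<open>Let \<open>U\<close> be the set of realizations of a type. Colour a point by the first set containing it
  in an enumeration of the singletons and the translates of \<open>U\<close>. A copy \<open>S\<close> of \<open>M\<close> meets some
  translate in an infinite set, which receives only finitely many colours, so \<open>S\<close> is not
  heterochromatic. A monochromatic copy lies in a translate of \<open>U\<close>.\<close>

lemma canonical_point_ramsey_imp_locally_replicable:
  assumes "relational_fraisse L M" "strong_amalgamation L M" "canonical_point_ramsey M"
  shows "locally_replicable L M"
proof -
  have L: "is_structure L M" and cnt: "countable (carrier M)" and inf: "infinite (carrier M)"
    and hom: "ultrahomogeneous M"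
    using assms(1) unfolding relational_fraisse_def by auto
  have "\<exists>S \<subseteq> realizations M A b id. is_copy M S"
    if A: "finite A" "A \<subseteq> carrier M" and b: "b \<in> carrier M - A" for A b
  proof -
    have bA: "insert b A \<subseteq> carrier M"
      using A b by blast
    \<comment> \<open>Countable because \<open>A\<close> is finite. Maps that do not embed
      \<open>A\<close> contribute only the empty set; the singletons ensure that every point of
      \<open>M\<close> lies in some member.\<close>
    define F where
      "F = realizations M A b ` (A \<rightarrow>\<^sub>E carrier M) \<union> (\<lambda>x. {x}) ` carrier M"
    have F: "countable F" "F \<noteq> {}"
      using countable_PiE[OF A(1), of "\<lambda>_. carrier M"] cnt inf unfolding F_def by auto
    define col where "col v = (LEAST i. v \<in> from_nat_into F i)" for v
    have mem: "v \<in> from_nat_into F (col v)" if "v \<in> carrier M" for v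
    proof -
      have "{v} \<in> F"
        using that unfolding F_def by blast
      then obtain i where "from_nat_into F i = {v}"
        using from_nat_into_surj[OF F(1)] by blast
      then show ?thesis
        unfolding col_def by (metis LeastI insertI1)
    qed
    obtain S where S: "is_copy M S" "(\<forall>x\<in>S. \<forall>y\<in>S. col x = col y) \<or> inj_on col S"
      using assms(3) unfolding canonical_point_ramsey_def by blast
    obtain k where k: "embedding M M k" "k ` carrier M = S"
      using S(1) unfolding is_copy_iff by blast
    have "\<not> inj_on col S"
    proof
      assume inj: "inj_on col S"
      let ?U = "realizations M A b id"
      \<comment> \<open>\<open>restrict\<close> makes \<open>k\<close> a member of the extensional
        function space; the realizations depend only on the values on \<open>A\<close>.\<close>
      have "restrict k A \<in> A \<rightarrow>\<^sub>E carrier M"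
        using k(1) A unfolding embedding_def by auto
      then have "realizations M A b (restrict k A) \<in> F"
        unfolding F_def by blast
      then obtain i where i: "from_nat_into F i = realizations M A b (restrict k A)"
        using from_nat_into_surj[OF F(1)] by blast
      have "k ` ?U \<subseteq> realizations M A b (k \<circ> id)"
        by (rule image_realizations[OF k(1) bA])
      also have "\<dots> = from_nat_into F i"
        unfolding i by (rule realizations_cong) simp
      finally have "col ` k ` ?U \<subseteq> {..i}"
        unfolding col_def by (auto intro!: Least_le)
      then have "finite (col ` k ` ?U)"
        using finite_subset by blast
      moreover have UM: "?U \<subseteq> carrier M"
        unfolding realizations_def by blast
      moreover have "inj_on col (k ` ?U)"
        using inj k(2) UM by (meson image_mono inj_on_subset order_refl subset_trans)
      ultimately have "finite ?U"
        using k(1) unfolding embedding_def by (metis finite_imageD inj_on_subset)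
      then show False
        using infinite_realizations[OF L hom assms(2) A b] by blast
    qed
    then have mono: "\<forall>x\<in>S. \<forall>y\<in>S. col x = col y"
      using S(2) by blast
    have infS: "infinite S"
      using infinite_copy[OF S(1) inf] .
    then obtain x where x: "x \<in> S"
      by fastforce
    have SM: "S \<subseteq> carrier M"
      using S(1) unfolding is_copy_def by blast
    have SF: "S \<subseteq> from_nat_into F (col x)"
      using mono x mem SM by (metis subsetD subsetI)
    \<comment> \<open>An infinite set fits in no singleton, so the common colour is the index of a
      translate.\<close>
    then have "from_nat_into F (col x) \<notin> (\<lambda>x. {x}) ` carrier M"
      using infS finite_subset by fastforce
    then obtain f where f: "from_nat_into F (col x) = realizations M A b f"
      using from_nat_into[OF F(2), of "col x"] unfolding F_def by blast
    \<comment> \<open>As \<open>x\<close> realizes the moved type, \<open>f\<close> embeds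
      \<open>A\<close> and agrees there with an automorphism \<open>g\<close>; its inverse
      \<open>s\<close> carries the moved type back to the original one.\<close>
    have "embedding (induced M (insert b A)) M (f(b := x))"
      using SF x f unfolding realizations_def by blast
    then have "embedding (induced M A) M (f(b := x))"
      by (rule embedding_induced_subset) blast
    then obtain g where g: "isomorphism M M g" "\<And>y. y \<in> A \<Longrightarrow> g y = (f(b := x)) y"
      using ultrahomogeneous_extend[OF hom A] by blast
    obtain s where s: "isomorphism M M s" "\<And>x. x \<in> carrier M \<Longrightarrow> s (g x) = x"
      using isomorphism_inverse[OF g(1)] by metis
    have sM: "embedding M M s"
      using s(1) unfolding isomorphism_def by blast
    have "s ` S \<subseteq> realizations M A b (s \<circ> f)"
      using image_realizations[OF sM bA] SF unfolding f by blast
    also have "\<dots> = realizations M A b id"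
    proof (rule realizations_cong)
      fix y assume "y \<in> A"
      then have "g y = f y" "y \<in> carrier M"
        using g(2) A b by auto
      then show "(s \<circ> f) y = id y"
        using s(2)[of y] by simp
    qed
    finally show ?thesis
      using is_copy_image[OF S(1) sM] by blast
  qed
  then show ?thesis
    unfolding locally_replicable_iff[OF L] by blast
qed

theorem proposition2p15:
  fixes L :: "'r rel_language" and M :: "('r, 'a) rel_struct"
  assumes "relational_fraisse L M"
    and "strong_amalgamation L M"
  shows "(canonical_point_ramsey M \<longleftrightarrow> galah M) \<and> (galah M \<longleftrightarrow> locally_replicable L M)"
  using assms galah_imp_locally_replicable locally_replicable_imp_galah
    galah_imp_canonical_point_ramsey canonical_point_ramsey_imp_locally_replicable
  by blast

end
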